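(* An inverse semigroup is nilpotent (in the sense of universal algebra) if and only if it is a nilpotent group; and an inverse semigroup is solvable (in the sense of universal algebra) if and only if it is a solvable group.
   Context: An inverse semigroup $S$ is a semigroup in which every $x$ has a unique inverse $x^{-1}$ with $xx^{-1}x=x$ and $x^{-1}xx^{-1}=x^{-1}$; it is viewed as an algebra $(S,\cdot,{}^{-1})$. A congruence is an equivalence relation compatible with multiplication and inversion; $0_S$ is equality and $1_S=S\times S$. For congruences $\alpha,\beta$ of $S$ and an $(n+1)$-ary term $t$ ($n\ge 1$) in the language $\{\cdot,{}^{-1}\}$, the term condition $\mathrm{TC}(t,\alpha,\beta)$ says: for all $a\,\alpha\,b$ and all $u_i\,\beta\,v_i$ ($1\le i\le n$), $t(a,u_1,\dots,u_n)=t(a,v_1,\dots,v_n)$ implies $t(b,u_1,\dots,u_n)=t(b,v_1,\dots,v_n)$. We say $\alpha$ centralizes $\beta$ if $\mathrm{TC}(t,\alpha,\beta)$ holds for every term $t$ of arity $\ge 2$. A congruence $\alpha$ of $S$ is abelian if $\alpha$ centralizes $\alpha$, and central if $\alpha$ centralizes $1_S$. $S$ is nilpotent (resp. solvable) in the sense of universal algebra if there is a finite chain of congruences $0_S=\alpha_0\le\alpha_1\le\dots\le\alpha_n=1_S$ such that $\alpha_{i+1}/\alpha_i$ is a central (resp. abelian) congruence of $S/\alpha_i$ for all $i$. "Nilpotent group" and "solvable group" have their classical group-theoretic meaning. *)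

theory Defs
  imports "HOL-Algebra.Solvable_Groups"
begin

section \<open>Inverse semigroups as algebras of type (2, 1)\<close>

record 'a inv_algebra = "'a partial_object" +
  sg_mult :: "'a \<Rightarrow> 'a \<Rightarrow> 'a"  (infixl \<open>\<cdot>\<index>\<close> 70)
  sg_inv :: "'a \<Rightarrow> 'a"

text \<open>As usual in algebra, the empty semigroup is excluded.\<close>

locale inverse_semigroup =
  fixes S :: "'a inv_algebra" (structure)
  assumes nonempty: "carrier S \<noteq> {}"
    and mult_closed: "\<lbrakk>x \<in> carrier S; y \<in> carrier S\<rbrakk> \<Longrightarrow> x \<cdot> y \<in> carrier S"
    and mult_assoc: "\<lbrakk>x \<in> carrier S; y \<in> carrier S; z \<in> carrier S\<rbrakk>
          \<Longrightarrow> (x \<cdot> y) \<cdot> z = x \<cdot> (y \<cdot> z)"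
    and inv_closed: "x \<in> carrier S \<Longrightarrow> sg_inv S x \<in> carrier S"
    and mult_inv_mult: "x \<in> carrier S \<Longrightarrow> x \<cdot> sg_inv S x \<cdot> x = x"
    and inv_mult_inv: "x \<in> carrier S \<Longrightarrow> sg_inv S x \<cdot> x \<cdot> sg_inv S x = sg_inv S x"
    and inv_unique: "\<lbrakk>x \<in> carrier S; y \<in> carrier S; x \<cdot> y \<cdot> x = x; y \<cdot> x \<cdot> y = y\<rbrakk>
          \<Longrightarrow> y = sg_inv S x"


section \<open>Congruences and quotients\<close>

text \<open>\<^const>\<open>equiv\<close> already includes \<open>\<alpha> \<subseteq> carrier S \<times> carrier S\<close>.\<close>

definition sg_congruence :: "'a inv_algebra \<Rightarrow> ('a \<times> 'a) set \<Rightarrow> bool" where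
  "sg_congruence S \<alpha> \<longleftrightarrow>
     equiv (carrier S) \<alpha> \<and>
     (\<forall>x x' y y'. (x, x') \<in> \<alpha> \<longrightarrow> (y, y') \<in> \<alpha> \<longrightarrow> (x \<cdot>\<^bsub>S\<^esub> y, x' \<cdot>\<^bsub>S\<^esub> y') \<in> \<alpha>) \<and>
     (\<forall>x x'. (x, x') \<in> \<alpha> \<longrightarrow> (sg_inv S x, sg_inv S x') \<in> \<alpha>)"

definition zero_cong :: "'a inv_algebra \<Rightarrow> ('a \<times> 'a) set" where
  "zero_cong S = Id_on (carrier S)"

definition one_cong :: "'a inv_algebra \<Rightarrow> ('a \<times> 'a) set" where
  "one_cong S = carrier S \<times> carrier S"

text \<open>The unions below are over singleton families when \<open>\<alpha>\<close> is a congruence and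
  \<open>X\<close>, \<open>Y\<close> are classes of \<open>\<alpha>\<close>.\<close>

definition quot_algebra :: "'a inv_algebra \<Rightarrow> ('a \<times> 'a) set \<Rightarrow> 'a set inv_algebra" where
  "quot_algebra S \<alpha> =
     \<lparr>carrier = carrier S // \<alpha>,
      sg_mult = (\<lambda>X Y. \<Union>x\<in>X. \<Union>y\<in>Y. \<alpha> `` {x \<cdot>\<^bsub>S\<^esub> y}),
      sg_inv = (\<lambda>X. \<Union>x\<in>X. \<alpha> `` {sg_inv S x})\<rparr>"

text \<open>The congruence \<open>\<beta>/\<alpha>\<close> of \<open>S/\<alpha>\<close>, for \<open>\<alpha> \<subseteq> \<beta>\<close>.\<close>

definition quot_cong :: "('a \<times> 'a) set \<Rightarrow> ('a \<times> 'a) set \<Rightarrow> ('a set \<times> 'a set) set" where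
  "quot_cong \<beta> \<alpha> = {(\<alpha> `` {x}, \<alpha> `` {y}) | x y. (x, y) \<in> \<beta>}"


section \<open>Terms and the term condition\<close>

datatype sg_term = TVar nat | TMult sg_term sg_term | TInv sg_term

primrec term_vars :: "sg_term \<Rightarrow> nat set" where
  "term_vars (TVar i) = {i}"
| "term_vars (TMult s t) = term_vars s \<union> term_vars t"
| "term_vars (TInv t) = term_vars t"

primrec term_eval :: "'a inv_algebra \<Rightarrow> (nat \<Rightarrow> 'a) \<Rightarrow> sg_term \<Rightarrow> 'a" where
  "term_eval S e (TVar i) = e i"
| "term_eval S e (TMult s t) = term_eval S e s \<cdot>\<^bsub>S\<^esub> term_eval S e t"
| "term_eval S e (TInv t) = sg_inv S (term_eval S e t)"

text \<open>An \<open>(n+1)\<close>-ary term is a term in the variables \<open>0, \<dots>, n\<close>. Variable \<open>0\<close> is the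
  distinguished first argument: \<open>u(0 := a)\<close> is the tuple \<open>(a, u\<^sub>1, \<dots>, u\<^sub>n)\<close>, and the values
  of \<open>u\<close> outside \<open>{1..n}\<close> play no role.\<close>

definition term_condition ::
  "'a inv_algebra \<Rightarrow> nat \<Rightarrow> sg_term \<Rightarrow> ('a \<times> 'a) set \<Rightarrow> ('a \<times> 'a) set \<Rightarrow> bool" where
  "term_condition S n t \<alpha> \<beta> \<longleftrightarrow>
     (\<forall>a b u v. (a, b) \<in> \<alpha> \<longrightarrow> (\<forall>i\<in>{1..n}. (u i, v i) \<in> \<beta>) \<longrightarrow>
        term_eval S (u(0 := a)) t = term_eval S (v(0 := a)) t \<longrightarrow>
        term_eval S (u(0 := b)) t = term_eval S (v(0 := b)) t)"

definition centralizes ::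
  "'a inv_algebra \<Rightarrow> ('a \<times> 'a) set \<Rightarrow> ('a \<times> 'a) set \<Rightarrow> bool" where
  "centralizes S \<alpha> \<beta> \<longleftrightarrow>
     (\<forall>n\<ge>1. \<forall>t. term_vars t \<subseteq> {0..n} \<longrightarrow> term_condition S n t \<alpha> \<beta>)"

definition abelian_cong :: "'a inv_algebra \<Rightarrow> ('a \<times> 'a) set \<Rightarrow> bool" where
  "abelian_cong S \<alpha> \<longleftrightarrow> sg_congruence S \<alpha> \<and> centralizes S \<alpha> \<alpha>"

definition central_cong :: "'a inv_algebra \<Rightarrow> ('a \<times> 'a) set \<Rightarrow> bool" where
  "central_cong S \<alpha> \<longleftrightarrow> sg_congruence S \<alpha> \<and> centralizes S \<alpha> (one_cong S)"


section \<open>Nilpotency and solvability in the sense of universal algebra\<close>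

definition congruence_chain :: "'a inv_algebra \<Rightarrow> nat \<Rightarrow> (nat \<Rightarrow> ('a \<times> 'a) set) \<Rightarrow> bool" where
  "congruence_chain S n \<alpha> \<longleftrightarrow>
     \<alpha> 0 = zero_cong S \<and> \<alpha> n = one_cong S \<and>
     (\<forall>i\<le>n. sg_congruence S (\<alpha> i)) \<and> (\<forall>i<n. \<alpha> i \<subseteq> \<alpha> (Suc i))"

definition ua_nilpotent :: "'a inv_algebra \<Rightarrow> bool" where
  "ua_nilpotent S \<longleftrightarrow>
     (\<exists>n \<alpha>. congruence_chain S n \<alpha> \<and>
        (\<forall>i<n. central_cong (quot_algebra S (\<alpha> i)) (quot_cong (\<alpha> (Suc i)) (\<alpha> i))))"

definition ua_solvable :: "'a inv_algebra \<Rightarrow> bool" where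
  "ua_solvable S \<longleftrightarrow>
     (\<exists>n \<alpha>. congruence_chain S n \<alpha> \<and>
        (\<forall>i<n. abelian_cong (quot_algebra S (\<alpha> i)) (quot_cong (\<alpha> (Suc i)) (\<alpha> i))))"


section \<open>Nilpotent and solvable groups\<close>

definition group_center :: "('a, 'b) monoid_scheme \<Rightarrow> 'a set" where
  "group_center G = {z \<in> carrier G. \<forall>g\<in>carrier G. z \<otimes>\<^bsub>G\<^esub> g = g \<otimes>\<^bsub>G\<^esub> z}"

text \<open>Existence of a central series \<open>1 = H\<^sub>0 \<le> \<dots> \<le> H\<^sub>n = G\<close>: each \<open>H\<^sub>i\<close> is normal in \<open>G\<close>
  and \<open>H\<^sub>i\<^sub>+\<^sub>1/H\<^sub>i\<close> lies in the center of \<open>G/H\<^sub>i\<close>.\<close>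

definition nilpotent_group :: "('a, 'b) monoid_scheme \<Rightarrow> bool" where
  "nilpotent_group G \<longleftrightarrow> group G \<and>
     (\<exists>n H. H 0 = {\<one>\<^bsub>G\<^esub>} \<and> H n = carrier G \<and> (\<forall>i\<le>n. H i \<lhd> G) \<and>
        (\<forall>i<n. H i \<subseteq> H (Suc i) \<and>
           carrier (G\<lparr>carrier := H (Suc i)\<rparr> Mod H i) \<subseteq> group_center (G Mod H i)))"

definition solvable_group :: "('a, 'b) monoid_scheme \<Rightarrow> bool" where
  "solvable_group G \<longleftrightarrow> group G \<and> solvable G"

text \<open>\<open>S\<close> viewed as a monoid structure with \<open>e\<close> as its unit. If this is a group, then \<open>e\<close> is
  determined by \<open>S\<close>, and for an inverse semigroup \<open>S\<close> group inversion agrees with \<open>sg_inv S\<close>.\<close>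

definition as_monoid :: "'a inv_algebra \<Rightarrow> 'a \<Rightarrow> 'a monoid" where
  "as_monoid S e = \<lparr>carrier = carrier S, mult = sg_mult S, one = e\<rparr>"

definition is_nilpotent_group :: "'a inv_algebra \<Rightarrow> bool" where
  "is_nilpotent_group S \<longleftrightarrow> (\<exists>e. nilpotent_group (as_monoid S e))"

definition is_solvable_group :: "'a inv_algebra \<Rightarrow> bool" where
  "is_solvable_group S \<longleftrightarrow> (\<exists>e. solvable_group (as_monoid S e))"

end

theory Submission
  imports Defs
begin

text \<open>Applied to the term \<open>x y\<close>, the term condition forces an abelian congruence to separate
  idempotents; so along a solvable chain all idempotents collapse into one, and an inverse semigroup
  with a single idempotent is a group. In a group, \<open>\<alpha>\<close> centralizes \<open>\<beta>\<close> iff the normal subgroups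
  corresponding to \<open>\<alpha>\<close> and \<open>\<beta>\<close> commute elementwise. Hence chains of congruences with central (abelian)
  factors correspond to normal series with central (abelian) factors.\<close>

section \<open>Congruences and quotients\<close>

text \<open>The factors of a chain live in quotients, and arguing with idempotents there would
  require lifting them back to S. The descent therefore keeps two idempotents of S fixed and
  compares only their classes. Uniqueness of inverses is exploited in S itself: it makes idempotents
  commute, and later it identifies group inversion with \<open>sg_inv\<close>.

  On the group side there is a mismatch. A congruence yields a subgroup normal in the whole group,
  whereas solvability asks only for a series in which each term is normal in the next. The derived
  series bridges this: its terms are normal in the whole group, and it descends at least as fast as
  any series with abelian factors.\<close>

lemma as_monoid_simps [simp]:
  "carrier (as_monoid S e) = carrier S"
  "mult (as_monoid S e) = sg_mult S"
  "one (as_monoid S e) = e"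
  by (simp_all add: as_monoid_def)

lemma sg_congruenceD:
  assumes "sg_congruence S \<alpha>"
  shows sg_congruence_equiv: "equiv (carrier S) \<alpha>"
    and sg_congruence_mult: "(x, x') \<in> \<alpha> \<Longrightarrow> (y, y') \<in> \<alpha> \<Longrightarrow> (x \<cdot>\<^bsub>S\<^esub> y, x' \<cdot>\<^bsub>S\<^esub> y') \<in> \<alpha>"
    and sg_congruence_inv: "(x, x') \<in> \<alpha> \<Longrightarrow> (sg_inv S x, sg_inv S x') \<in> \<alpha>"
    and sg_congruence_refl: "x \<in> carrier S \<Longrightarrow> (x, x) \<in> \<alpha>"
    and sg_congruence_sym: "(x, x') \<in> \<alpha> \<Longrightarrow> (x', x) \<in> \<alpha>"
    and sg_congruence_trans: "(x, x') \<in> \<alpha> \<Longrightarrow> (x', z) \<in> \<alpha> \<Longrightarrow> (x, z) \<in> \<alpha>"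
    and sg_congruence_carrier1: "(x, x') \<in> \<alpha> \<Longrightarrow> x \<in> carrier S"
    and sg_congruence_carrier2: "(x, x') \<in> \<alpha> \<Longrightarrow> x' \<in> carrier S"
proof -
  show equiv: "equiv (carrier S) \<alpha>" using assms by (simp add: sg_congruence_def)
  show "(x, x') \<in> \<alpha> \<Longrightarrow> (y, y') \<in> \<alpha> \<Longrightarrow> (x \<cdot>\<^bsub>S\<^esub> y, x' \<cdot>\<^bsub>S\<^esub> y') \<in> \<alpha>"
    and "(x, x') \<in> \<alpha> \<Longrightarrow> (sg_inv S x, sg_inv S x') \<in> \<alpha>"
    using assms by (simp_all add: sg_congruence_def)
  show "x \<in> carrier S \<Longrightarrow> (x, x) \<in> \<alpha>"
    using equiv by (simp add: equiv_def refl_on_def)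
  show "(x, x') \<in> \<alpha> \<Longrightarrow> (x', x) \<in> \<alpha>"
    using equiv by (simp add: equiv_def symD)
  show "(x, x') \<in> \<alpha> \<Longrightarrow> (x', z) \<in> \<alpha> \<Longrightarrow> (x, z) \<in> \<alpha>"
    using equiv unfolding equiv_def by (blast dest: transD)
  show "(x, x') \<in> \<alpha> \<Longrightarrow> x \<in> carrier S" and "(x, x') \<in> \<alpha> \<Longrightarrow> x' \<in> carrier S"
    using equiv_type[OF equiv] by blast+
qed

lemma term_eval_congruence:
  assumes "sg_congruence S \<alpha>" "\<And>i. i \<in> term_vars t \<Longrightarrow> (u i, v i) \<in> \<alpha>"
  shows "(term_eval S u t, term_eval S v t) \<in> \<alpha>"
  using assms(2)
  by (induction t) (auto intro: sg_congruence_mult[OF assms(1)] sg_congruence_inv[OF assms(1)])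

lemma centralizes_mono:
  assumes "centralizes S \<alpha> \<beta>" "\<gamma> \<subseteq> \<beta>"
  shows "centralizes S \<alpha> \<gamma>"
  using assms unfolding centralizes_def term_condition_def by (meson subsetD)

text \<open>Centralizing weakens when the second congruence shrinks, here from
  \<open>one_cong S\<close> to \<alpha>. Through this the nilpotent case inherits the reduction to
  groups from the solvable case.\<close>

lemma central_cong_imp_abelian:
  assumes "central_cong S \<alpha>"
  shows "abelian_cong S \<alpha>"
  using assms centralizes_mono[of S \<alpha> "one_cong S" \<alpha>]
  by (auto simp: central_cong_def abelian_cong_def one_cong_def sg_congruence_def
      dest: equiv_type)

section \<open>Quotient algebras and quotient congruences\<close>

lemma quot_carrier [simp]: "carrier (quot_algebra S \<alpha>) = carrier S // \<alpha>"
  by (simp add: quot_algebra_def)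

lemma quot_class_eq_iff:
  assumes "sg_congruence S \<alpha>" "x \<in> carrier S" "y \<in> carrier S"
  shows "\<alpha> `` {x} = \<alpha> `` {y} \<longleftrightarrow> (x, y) \<in> \<alpha>"
  using eq_equiv_class_iff[OF sg_congruence_equiv[OF assms(1)]] assms(2,3) by blast

lemma quot_class_eqI:
  assumes "sg_congruence S \<alpha>" "(x, y) \<in> \<alpha>"
  shows "\<alpha> `` {x} = \<alpha> `` {y}"
  using equiv_class_eq[OF sg_congruence_equiv[OF assms(1)] assms(2)] .

lemma quot_mult:
  assumes \<alpha>: "sg_congruence S \<alpha>" and x: "x \<in> carrier S" and y: "y \<in> carrier S"
  shows "\<alpha> `` {x} \<cdot>\<^bsub>quot_algebra S \<alpha>\<^esub> \<alpha> `` {y} = \<alpha> `` {x \<cdot>\<^bsub>S\<^esub> y}"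
proof -
  have "\<alpha> `` {x' \<cdot>\<^bsub>S\<^esub> y'} = \<alpha> `` {x \<cdot>\<^bsub>S\<^esub> y}" if "(x, x') \<in> \<alpha>" "(y, y') \<in> \<alpha>" for x' y'
    using sg_congruence_mult[OF \<alpha> that] by (rule quot_class_eqI[OF \<alpha>, symmetric])
  then have "(\<Union>x'\<in>\<alpha> `` {x}. \<Union>y'\<in>\<alpha> `` {y}. \<alpha> `` {x' \<cdot>\<^bsub>S\<^esub> y'})
      = (\<Union>x'\<in>\<alpha> `` {x}. \<Union>y'\<in>\<alpha> `` {y}. \<alpha> `` {x \<cdot>\<^bsub>S\<^esub> y})"
    by (intro SUP_cong refl) (simp_all only: Image_singleton_iff)
  \<comment> \<open>A union of a constant family equals that constant only over a nonempty index
    set; reflexivity provides x and y as indices.\<close>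
  also have "\<dots> = \<alpha> `` {x \<cdot>\<^bsub>S\<^esub> y}"
    using sg_congruence_refl[OF \<alpha> x] sg_congruence_refl[OF \<alpha> y] by blast
  finally show ?thesis by (simp add: quot_algebra_def)
qed

lemma quot_inv:
  assumes \<alpha>: "sg_congruence S \<alpha>" and x: "x \<in> carrier S"
  shows "sg_inv (quot_algebra S \<alpha>) (\<alpha> `` {x}) = \<alpha> `` {sg_inv S x}"
proof -
  have "\<alpha> `` {sg_inv S x'} = \<alpha> `` {sg_inv S x}" if "(x, x') \<in> \<alpha>" for x'
    using sg_congruence_inv[OF \<alpha> that] by (rule quot_class_eqI[OF \<alpha>, symmetric])
  then have "(\<Union>x'\<in>\<alpha> `` {x}. \<alpha> `` {sg_inv S x'}) = (\<Union>x'\<in>\<alpha> `` {x}. \<alpha> `` {sg_inv S x})"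
    by (intro SUP_cong refl) (simp_all only: Image_singleton_iff)
  also have "\<dots> = \<alpha> `` {sg_inv S x}"
    using sg_congruence_refl[OF \<alpha> x] by blast
  finally show ?thesis by (simp add: quot_algebra_def)
qed

text \<open>Membership in \<open>quot_cong\<close> is witnessed by some pair of representatives.
  Since \<alpha> \<subseteq> \<beta>, passing to other representatives stays inside \<beta>, so
  every pair may be tested.\<close>

lemma quot_cong_iff:
  assumes \<alpha>: "sg_congruence S \<alpha>" and \<beta>: "sg_congruence S \<beta>" and "\<alpha> \<subseteq> \<beta>"
    and "x \<in> carrier S" "y \<in> carrier S"
  shows "(\<alpha> `` {x}, \<alpha> `` {y}) \<in> quot_cong \<beta> \<alpha> \<longleftrightarrow> (x, y) \<in> \<beta>"
proof
  assume "(\<alpha> `` {x}, \<alpha> `` {y}) \<in> quot_cong \<beta> \<alpha>"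
  then obtain x' y' where xy: "(x', y') \<in> \<beta>" "\<alpha> `` {x} = \<alpha> `` {x'}" "\<alpha> `` {y} = \<alpha> `` {y'}"
    by (auto simp: quot_cong_def)
  then have "(x, x') \<in> \<alpha>" "(y, y') \<in> \<alpha>"
    using assms(4,5) by (simp_all add: quot_class_eq_iff[OF \<alpha>] sg_congruence_carrier1[OF \<beta>]
        sg_congruence_carrier2[OF \<beta>])
  with xy(1) \<open>\<alpha> \<subseteq> \<beta>\<close> show "(x, y) \<in> \<beta>"
    by (meson sg_congruence_sym[OF \<beta>] sg_congruence_trans[OF \<beta>] subsetD)
qed (auto simp: quot_cong_def)

lemma quot_cong_congruence:
  assumes \<alpha>: "sg_congruence S \<alpha>" and \<beta>: "sg_congruence S \<beta>" and "\<alpha> \<subseteq> \<beta>"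
  shows "sg_congruence (quot_algebra S \<alpha>) (quot_cong \<beta> \<alpha>)"
proof -
  note carr = sg_congruence_carrier1[OF \<beta>] sg_congruence_carrier2[OF \<beta>]
  note iff = quot_cong_iff[OF assms]
  have cases: "\<exists>x y. X = \<alpha> `` {x} \<and> Y = \<alpha> `` {y} \<and> (x, y) \<in> \<beta>"
    if "(X, Y) \<in> quot_cong \<beta> \<alpha>" for X Y
    using that by (auto simp: quot_cong_def)
  have "equiv (carrier S // \<alpha>) (quot_cong \<beta> \<alpha>)"
  proof (rule equivI)
    show "quot_cong \<beta> \<alpha> \<subseteq> (carrier S // \<alpha>) \<times> (carrier S // \<alpha>)"
      by (auto simp: quot_cong_def intro!: quotientI dest: carr)
    show "refl_on (carrier S // \<alpha>) (quot_cong \<beta> \<alpha>)"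
      by (auto simp: refl_on_def iff sg_congruence_refl[OF \<beta>] elim!: quotientE)
    show "sym (quot_cong \<beta> \<alpha>)"
      by (rule symI) (auto simp: quot_cong_def dest: sg_congruence_sym[OF \<beta>])
    show "trans (quot_cong \<beta> \<alpha>)"
    proof (rule transI)
      fix X Y Z assume XY: "(X, Y) \<in> quot_cong \<beta> \<alpha>" and YZ: "(Y, Z) \<in> quot_cong \<beta> \<alpha>"
      obtain x y where xy: "X = \<alpha> `` {x}" "Y = \<alpha> `` {y}" "(x, y) \<in> \<beta>" using cases[OF XY] by blast
      obtain y' z where yz: "Y = \<alpha> `` {y'}" "Z = \<alpha> `` {z}" "(y', z) \<in> \<beta>"
        using cases[OF YZ] by blast
      \<comment> \<open>The middle class comes with two representatives y and y';
        \<open>quot_cong_iff\<close> moves the second relation from y' to y.\<close>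
      have "(y, z) \<in> \<beta>" using YZ xy yz by (metis iff carr)
      then have "(x, z) \<in> \<beta>" using xy(3) by (metis sg_congruence_trans[OF \<beta>])
      then show "(X, Z) \<in> quot_cong \<beta> \<alpha>" using xy yz by (auto simp: quot_cong_def)
    qed
  qed
  moreover have "(X \<cdot>\<^bsub>quot_algebra S \<alpha>\<^esub> Y, X' \<cdot>\<^bsub>quot_algebra S \<alpha>\<^esub> Y') \<in> quot_cong \<beta> \<alpha>"
    if XX: "(X, X') \<in> quot_cong \<beta> \<alpha>" and YY: "(Y, Y') \<in> quot_cong \<beta> \<alpha>" for X X' Y Y'
  proof -
    obtain x x' where x: "X = \<alpha> `` {x}" "X' = \<alpha> `` {x'}" "(x, x') \<in> \<beta>" using cases[OF XX] by blast
    obtain y y' where y: "Y = \<alpha> `` {y}" "Y' = \<alpha> `` {y'}" "(y, y') \<in> \<beta>" using cases[OF YY] by blast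
    have "(x \<cdot>\<^bsub>S\<^esub> y, x' \<cdot>\<^bsub>S\<^esub> y') \<in> \<beta>" using x y by (metis sg_congruence_mult[OF \<beta>])
    moreover have "X \<cdot>\<^bsub>quot_algebra S \<alpha>\<^esub> Y = \<alpha> `` {x \<cdot>\<^bsub>S\<^esub> y}"
      "X' \<cdot>\<^bsub>quot_algebra S \<alpha>\<^esub> Y' = \<alpha> `` {x' \<cdot>\<^bsub>S\<^esub> y'}"
      using x y by (metis carr quot_mult[OF \<alpha>])+
    ultimately show ?thesis unfolding quot_cong_def by blast
  qed
  moreover have "(sg_inv (quot_algebra S \<alpha>) X, sg_inv (quot_algebra S \<alpha>) X') \<in> quot_cong \<beta> \<alpha>"
    if XX: "(X, X') \<in> quot_cong \<beta> \<alpha>" for X X'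
  proof -
    obtain x x' where x: "X = \<alpha> `` {x}" "X' = \<alpha> `` {x'}" "(x, x') \<in> \<beta>" using cases[OF XX] by blast
    have "(sg_inv S x, sg_inv S x') \<in> \<beta>" using x by (metis sg_congruence_inv[OF \<beta>])
    moreover have "sg_inv (quot_algebra S \<alpha>) X = \<alpha> `` {sg_inv S x}"
      "sg_inv (quot_algebra S \<alpha>) X' = \<alpha> `` {sg_inv S x'}"
      using x by (metis carr quot_inv[OF \<alpha>])+
    ultimately show ?thesis unfolding quot_cong_def by blast
  qed
  ultimately show ?thesis by (simp add: sg_congruence_def)
qed

lemma one_cong_quot: "one_cong (quot_algebra S \<alpha>) = quot_cong (one_cong S) \<alpha>"
  by (auto simp: one_cong_def quot_cong_def quotient_def)

section \<open>Solvable inverse semigroups are groups\<close>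

context inverse_semigroup
begin

text \<open>Let x be the inverse of ef. Then fxe is idempotent because x(ef)x = x, and it is again
  an inverse of ef, so fxe = x by uniqueness. Thus x is idempotent and hence its own inverse; but ef
  is an inverse of x as well, so ef = x.\<close>

lemma idem_mult_idem:
  assumes e: "e \<in> carrier S" "e \<cdot> e = e" and f: "f \<in> carrier S" "f \<cdot> f = f"
  shows "(e \<cdot> f) \<cdot> (e \<cdot> f) = e \<cdot> f"
proof -
  define x where "x = sg_inv S (e \<cdot> f)"
  have c [simp]: "e \<in> carrier S" "f \<in> carrier S" "x \<in> carrier S"
    using e f by (simp_all add: x_def inv_closed mult_closed)
  \<comment> \<open>Products are normalised to the right, so each law is also needed with a trailing
    factor y.\<close>
  have e': "e \<cdot> (e \<cdot> y) = e \<cdot> y" and f': "f \<cdot> (f \<cdot> y) = f \<cdot> y" if "y \<in> carrier S" for y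
    using that e f by (metis mult_assoc)+
  have y1: "e \<cdot> (f \<cdot> (x \<cdot> (e \<cdot> f))) = e \<cdot> f"
    using mult_inv_mult[of "e \<cdot> f"] by (simp add: x_def[symmetric] mult_assoc mult_closed)
  have y2: "x \<cdot> (e \<cdot> (f \<cdot> x)) = x"
    using inv_mult_inv[of "e \<cdot> f"] by (simp add: x_def[symmetric] mult_assoc mult_closed)
  have y2': "x \<cdot> (e \<cdot> (f \<cdot> (x \<cdot> y))) = x \<cdot> y" if "y \<in> carrier S" for y
  proof -
    have "x \<cdot> (e \<cdot> (f \<cdot> (x \<cdot> y))) = x \<cdot> (e \<cdot> (f \<cdot> x)) \<cdot> y"
      using that by (simp add: mult_assoc mult_closed)
    then show ?thesis by (simp only: y2)
  qed
  have idem: "(f \<cdot> (x \<cdot> e)) \<cdot> (f \<cdot> (x \<cdot> e)) = f \<cdot> (x \<cdot> e)"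
    by (simp add: mult_assoc mult_closed y2' e(2))
  have "f \<cdot> (x \<cdot> e) = sg_inv S (e \<cdot> f)"
    by (rule inv_unique) (simp_all add: mult_assoc mult_closed y1 y2' e' f' e f)
  also have "\<dots> = x" by (simp add: x_def)
  finally have "x \<cdot> x = x" using idem by simp
  then have "x = sg_inv S x" by (intro inv_unique) simp_all
  moreover have "e \<cdot> f = sg_inv S x"
    by (rule inv_unique) (simp_all add: mult_assoc mult_closed y1 y2)
  ultimately show ?thesis using \<open>x \<cdot> x = x\<close> by simp
qed

text \<open>Both ef and fe are idempotent, and this makes each of them an inverse of ef.\<close>

lemma idem_commute:
  assumes e: "e \<in> carrier S" "e \<cdot> e = e" and f: "f \<in> carrier S" "f \<cdot> f = f"
  shows "e \<cdot> f = f \<cdot> e"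
proof -
  have c [simp]: "e \<in> carrier S" "f \<in> carrier S" using e f by simp_all
  have e': "e \<cdot> (e \<cdot> y) = e \<cdot> y" and f': "f \<cdot> (f \<cdot> y) = f \<cdot> y" if "y \<in> carrier S" for y
    using that e f by (metis mult_assoc)+
  have ef: "e \<cdot> (f \<cdot> (e \<cdot> f)) = e \<cdot> f" and fe: "f \<cdot> (e \<cdot> (f \<cdot> e)) = f \<cdot> e"
    using idem_mult_idem[OF e f] idem_mult_idem[OF f e] by (simp_all add: mult_assoc mult_closed)
  have "f \<cdot> e = sg_inv S (e \<cdot> f)"
    by (rule inv_unique) (simp_all add: mult_assoc mult_closed e' f' ef fe)
  moreover have "e \<cdot> f = sg_inv S (e \<cdot> f)"
    by (rule inv_unique) (simp_all add: mult_assoc mult_closed ef)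
  ultimately show ?thesis by simp
qed

text \<open>The term condition for \<open>x y\<close> at \<open>ef \<cdot> e = ef \<cdot> ef\<close> yields \<open>e \<cdot> e = e \<cdot> ef\<close>.\<close>

lemma abelian_quot_idem:
  assumes \<alpha>: "sg_congruence S \<alpha>" and \<beta>: "sg_congruence S \<beta>" and sub: "\<alpha> \<subseteq> \<beta>"
    and ab: "abelian_cong (quot_algebra S \<alpha>) (quot_cong \<beta> \<alpha>)"
    and e: "e \<in> carrier S" "e \<cdot> e = e" and f: "f \<in> carrier S" "f \<cdot> f = f"
    and ef: "(e, f) \<in> \<beta>"
  shows "(e, f) \<in> \<alpha>"
proof -
  \<comment> \<open>Stated for arbitrary e and f in order to be applied to both orders of the pair:
    as ef = fe, the two results meet in the same element.\<close>
  have *: "(e, e \<cdot> f) \<in> \<alpha>"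
    if e: "e \<in> carrier S" "e \<cdot> e = e" and f: "f \<in> carrier S" "f \<cdot> f = f"
      and ef: "(e, f) \<in> \<beta>" for e f
  proof -
    define g where "g = e \<cdot> f"
    have c: "g \<in> carrier S" using e f by (simp add: g_def mult_closed)
    have gg: "g \<cdot> g = g" using idem_mult_idem[OF e f] by (simp add: g_def)
    have ge: "g \<cdot> e = g"
      unfolding g_def using e f idem_commute[OF e f] by (metis mult_assoc)
    have eg: "e \<cdot> g = g"
      unfolding g_def using e f by (metis mult_assoc)
    have "(g, e) \<in> \<beta>"
      using sg_congruence_mult[OF \<beta> sg_congruence_refl[OF \<beta> e(1)] ef] e(2)
      by (simp add: g_def sg_congruence_sym[OF \<beta>])
    then have ge': "(\<alpha> `` {g}, \<alpha> `` {e}) \<in> quot_cong \<beta> \<alpha>" "(\<alpha> `` {e}, \<alpha> `` {g}) \<in> quot_cong \<beta> \<alpha>"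
      by (auto simp: quot_cong_def dest: sg_congruence_sym[OF \<beta>])
    have "term_condition (quot_algebra S \<alpha>) 1 (TMult (TVar 0) (TVar 1))
            (quot_cong \<beta> \<alpha>) (quot_cong \<beta> \<alpha>)"
      using ab by (simp add: abelian_cong_def centralizes_def)
    from this[unfolded term_condition_def, rule_format, OF ge'(1),
        of "\<lambda>_. \<alpha> `` {e}" "\<lambda>_. \<alpha> `` {g}"]
    have "\<alpha> `` {e} = \<alpha> `` {g}"
      using ge' e c by (simp add: quot_mult[OF \<alpha>] ge gg eg)
    then show ?thesis using e c by (simp add: quot_class_eq_iff[OF \<alpha>] g_def)
  qed
  have "(e, e \<cdot> f) \<in> \<alpha>" "(f, e \<cdot> f) \<in> \<alpha>"
    using *[OF e f ef] *[OF f e sg_congruence_sym[OF \<beta> ef]] idem_commute[OF e f] by simp_all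
  then show ?thesis by (meson sg_congruence_sym[OF \<alpha>] sg_congruence_trans[OF \<alpha>])
qed

lemma ua_solvable_idem_unique:
  assumes "ua_solvable S"
    and e: "e \<in> carrier S" "e \<cdot> e = e" and f: "f \<in> carrier S" "f \<cdot> f = f"
  shows "e = f"
proof -
  obtain n \<alpha> where chain: "congruence_chain S n \<alpha>"
    and ab: "\<And>i. i < n \<Longrightarrow> abelian_cong (quot_algebra S (\<alpha> i)) (quot_cong (\<alpha> (Suc i)) (\<alpha> i))"
    using assms(1) by (auto simp: ua_solvable_def)
  \<comment> \<open>Downward induction: \<open>one_cong S\<close> relates any two idempotents, each
    abelian factor hands the relation to the next smaller congruence, and the bottom one is
    equality.\<close>
  have "(e, f) \<in> \<alpha> (0::nat)"
  proof (rule inc_induct[of 0 n])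
    show "(e, f) \<in> \<alpha> n" using chain e f by (simp add: congruence_chain_def one_cong_def)
    show "(e, f) \<in> \<alpha> i" if i: "i < n" and ef: "(e, f) \<in> \<alpha> (Suc i)" for i
    proof -
      have "sg_congruence S (\<alpha> i)" "sg_congruence S (\<alpha> (Suc i))" "\<alpha> i \<subseteq> \<alpha> (Suc i)"
        using i chain unfolding congruence_chain_def by simp_all
      then show ?thesis using ab[OF i] e f ef by (rule abelian_quot_idem)
    qed
  qed simp
  moreover have "\<alpha> 0 = zero_cong S" using chain unfolding congruence_chain_def by simp
  ultimately show ?thesis by (simp add: zero_cong_def Id_on_iff)
qed

text \<open>Both \<open>x \<cdot> sg_inv S x\<close> and \<open>sg_inv S x \<cdot> x\<close> are
  idempotent, hence equal to the single idempotent e. So \<open>sg_inv S x\<close> is an inverse of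
  x with respect to e, and ex = x is the law \<open>mult_inv_mult\<close>.\<close>

lemma group_if_idem_unique:
  assumes uniq: "\<And>e f. e \<in> carrier S \<Longrightarrow> e \<cdot> e = e \<Longrightarrow> f \<in> carrier S \<Longrightarrow> f \<cdot> f = f \<Longrightarrow> e = f"
  obtains e where "group (as_monoid S e)"
proof -
  have idem: "(x \<cdot> sg_inv S x) \<cdot> (x \<cdot> sg_inv S x) = x \<cdot> sg_inv S x"
    "(sg_inv S x \<cdot> x) \<cdot> (sg_inv S x \<cdot> x) = sg_inv S x \<cdot> x" if "x \<in> carrier S" for x
    using that mult_inv_mult[OF that] inv_mult_inv[OF that]
    by (metis mult_assoc inv_closed mult_closed)+
  obtain a where a: "a \<in> carrier S" using nonempty by blast
  define e where "e = a \<cdot> sg_inv S a"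
  have e: "e \<in> carrier S" "e \<cdot> e = e" using a idem by (simp_all add: e_def inv_closed mult_closed)
  have xe: "x \<cdot> sg_inv S x = e" "sg_inv S x \<cdot> x = e" if "x \<in> carrier S" for x
    using that idem[OF that] e by (metis uniq mult_closed inv_closed)+
  have "group (as_monoid S e)"
  proof (rule groupI; simp)
    show "e \<in> carrier S" by (rule e)
    show "e \<cdot> x = x" if "x \<in> carrier S" for x using that mult_inv_mult xe by metis
    show "\<exists>y\<in>carrier S. y \<cdot> x = e" if "x \<in> carrier S" for x using that xe inv_closed by blast
  qed (simp_all add: mult_closed mult_assoc)
  then show thesis by (rule that)
qed

end

section \<open>Groups as algebras of type (2, 1)\<close>

text \<open>Formulated independently of \<open>inverse_semigroup\<close>, so that a quotient can be
  made an instance directly and all facts about groups then hold in it by interpretation.\<close>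

locale group_algebra =
  fixes S :: "'a inv_algebra" (structure) and e :: 'a
  assumes group: "group (as_monoid S e)"
    and sg_inv: "x \<in> carrier S \<Longrightarrow> sg_inv S x = inv\<^bsub>as_monoid S e\<^esub> x"

sublocale group_algebra \<subseteq> group "as_monoid S e"
  rewrites "carrier (as_monoid S e) = carrier S"
    and "mult (as_monoid S e) = sg_mult S"
    and "one (as_monoid S e) = e"
  using group by simp_all

text \<open>A group inverse satisfies both equations of a semigroup inverse, so uniqueness
  identifies the two inversions.\<close>

lemma (in inverse_semigroup) group_algebraI:
  assumes "group (as_monoid S e)"
  shows "group_algebra S e"
proof (intro group_algebra.intro assms)
  interpret grp: group "as_monoid S e" by fact
  fix x assume x: "x \<in> carrier S"
  have c: "inv\<^bsub>as_monoid S e\<^esub> x \<in> carrier S" using grp.inv_closed[of x] x by simp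
  have xe: "x \<cdot> inv\<^bsub>as_monoid S e\<^esub> x = e" "inv\<^bsub>as_monoid S e\<^esub> x \<cdot> x = e"
    using x grp.r_inv[of x] grp.l_inv[of x] by simp_all
  have "e \<cdot> y = y" if "y \<in> carrier S" for y using that grp.l_one[of y] by simp
  then show "sg_inv S x = inv\<^bsub>as_monoid S e\<^esub> x"
    using x c by (intro inv_unique[symmetric]) (simp_all only: xe)
qed

context group_algebra
begin

abbreviation G :: "'a monoid" where "G \<equiv> as_monoid S e"

lemma cancel_inv [simp]:
  assumes "x \<in> carrier S" "y \<in> carrier S"
  shows "x \<cdot> (inv\<^bsub>G\<^esub> x \<cdot> y) = y" and "inv\<^bsub>G\<^esub> x \<cdot> (x \<cdot> y) = y"
  using assms by (simp_all flip: m_assoc)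

lemma eq_mult_if_inv:
  assumes "p = x \<cdot> inv\<^bsub>G\<^esub> y" "x \<in> carrier S" "y \<in> carrier S"
  shows "x = p \<cdot> y"
  using assms by (simp add: m_assoc)

lemma one_cong_congruence: "sg_congruence S (one_cong S)"
  by (auto simp: sg_congruence_def one_cong_def sg_inv equiv_def refl_on_def sym_def trans_def)

text \<open>Multiply on the right by y or by its inverse. A congruence of a group is therefore
  determined by the class of the unit.\<close>

lemma class_one_iff:
  assumes \<alpha>: "sg_congruence S \<alpha>" and "x \<in> carrier S" "y \<in> carrier S"
  shows "(x \<cdot> inv\<^bsub>G\<^esub> y, e) \<in> \<alpha> \<longleftrightarrow> (x, y) \<in> \<alpha>"
proof
  assume "(x \<cdot> inv\<^bsub>G\<^esub> y, e) \<in> \<alpha>"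
  from sg_congruence_mult[OF \<alpha> this sg_congruence_refl[OF \<alpha> assms(3)]]
  show "(x, y) \<in> \<alpha>" using assms by (simp add: m_assoc)
next
  assume "(x, y) \<in> \<alpha>"
  from sg_congruence_mult[OF \<alpha> this sg_congruence_refl[OF \<alpha> inv_closed[OF assms(3)]]]
  show "(x \<cdot> inv\<^bsub>G\<^esub> y, e) \<in> \<alpha>" using assms by simp
qed

lemma class_one_normal:
  assumes \<alpha>: "sg_congruence S \<alpha>"
  shows "{x. (x, e) \<in> \<alpha>} \<lhd> G"
proof (rule normal_invI)
  show "subgroup {x. (x, e) \<in> \<alpha>} G"
  proof (rule subgroupI)
    show "{x. (x, e) \<in> \<alpha>} \<subseteq> carrier S" using sg_congruence_carrier1[OF \<alpha>] by blast
    show "{x. (x, e) \<in> \<alpha>} \<noteq> {}" using sg_congruence_refl[OF \<alpha> one_closed] by blast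
    show "inv\<^bsub>G\<^esub> a \<in> {x. (x, e) \<in> \<alpha>}" if "a \<in> {x. (x, e) \<in> \<alpha>}" for a
      using that sg_congruence_inv[OF \<alpha>, of a e] sg_congruence_carrier1[OF \<alpha>, of a e]
      by (simp add: sg_inv)
    show "a \<cdot> b \<in> {x. (x, e) \<in> \<alpha>}" if "a \<in> {x. (x, e) \<in> \<alpha>}" "b \<in> {x. (x, e) \<in> \<alpha>}" for a b
      using that sg_congruence_mult[OF \<alpha>, of a e b e] by simp
  qed
  show "x \<cdot>\<^bsub>S\<^esub> h \<cdot>\<^bsub>S\<^esub> inv\<^bsub>G\<^esub> x \<in> {x. (x, e) \<in> \<alpha>}"
    if "x \<in> carrier S" "h \<in> {x. (x, e) \<in> \<alpha>}" for x h
  proof -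
    \<comment> \<open>Here xe = x, so \<open>class_one_iff\<close> turns this relation into closure
      under conjugation.\<close>
    have "(x \<cdot> h, x \<cdot> e) \<in> \<alpha>"
      using that by (intro sg_congruence_mult[OF \<alpha>] sg_congruence_refl[OF \<alpha>]) simp_all
    then show ?thesis using that class_one_iff[OF \<alpha>, of "x \<cdot> h" x] sg_congruence_carrier1[OF \<alpha>]
      by auto
  qed
qed

text \<open>For \<open>q \<alpha> e\<close>, the conjugate \<open>x q x\<inverse>\<close> depends only on the \<open>\<beta>\<close>-class of \<open>x\<close>; so for every term
  \<open>t\<close> the quotient \<open>t(b,u) t(a,u)\<inverse>\<close> depends only on the \<open>\<beta>\<close>-classes of \<open>u\<close>. The converse direction
  uses the commutator term.\<close>

lemma centralizes_iff:
  assumes \<alpha>: "sg_congruence S \<alpha>" and \<beta>: "sg_congruence S \<beta>"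
  shows "centralizes S \<alpha> \<beta> \<longleftrightarrow> (\<forall>x y. (x, e) \<in> \<alpha> \<longrightarrow> (y, e) \<in> \<beta> \<longrightarrow> x \<cdot> y = y \<cdot> x)"
proof (intro iffI allI impI)
  fix x y assume cent: "centralizes S \<alpha> \<beta>" and x: "(x, e) \<in> \<alpha>" and y: "(y, e) \<in> \<beta>"
  let ?t = "TMult (TMult (TVar 0) (TVar 1)) (TMult (TInv (TVar 0)) (TInv (TVar 1)))"
  have c: "x \<in> carrier S" "y \<in> carrier S"
    using x y sg_congruence_carrier1[OF \<alpha>] sg_congruence_carrier1[OF \<beta>] by simp_all
  have "term_condition S 1 ?t \<alpha> \<beta>"
    using cent by (simp add: centralizes_def)
  \<comment> \<open>With first argument e the commutator term takes the value e at both y and e.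
    Moving that argument from e to x gives [x,y] = [x,e] = e.\<close>
  from this[unfolded term_condition_def, rule_format, OF sg_congruence_sym[OF \<alpha> x],
      of "\<lambda>_. y" "\<lambda>_. e"]
  have "(x \<cdot> y) \<cdot> (inv\<^bsub>G\<^esub> x \<cdot> inv\<^bsub>G\<^esub> y) = e"
    using c y by (simp add: sg_inv)
  then have "(x \<cdot> y) \<cdot> inv\<^bsub>G\<^esub> (y \<cdot> x) = e" using c by (simp add: inv_mult_group)
  then show "x \<cdot> y = y \<cdot> x" using c by (metis inv_solve_right' m_closed one_closed l_one)
next
  assume comm: "\<forall>x y. (x, e) \<in> \<alpha> \<longrightarrow> (y, e) \<in> \<beta> \<longrightarrow> x \<cdot> y = y \<cdot> x"
  have conj: "x \<cdot> q \<cdot> inv\<^bsub>G\<^esub> x = y \<cdot> q \<cdot> inv\<^bsub>G\<^esub> y" if q: "(q, e) \<in> \<alpha>" and xy: "(x, y) \<in> \<beta>" for q x y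
  proof -
    have c: "q \<in> carrier S" "x \<in> carrier S" "y \<in> carrier S"
      using q xy sg_congruence_carrier1[OF \<alpha>] sg_congruence_carrier1[OF \<beta>]
        sg_congruence_carrier2[OF \<beta>] by blast+
    \<comment> \<open>The discrepancy between x and y: it is \<beta>-related to e, so it commutes
      with q and cancels from the conjugate.\<close>
    define k where "k = inv\<^bsub>G\<^esub> y \<cdot> x"
    have k: "k \<in> carrier S" using c by (simp add: k_def)
    have "(k, inv\<^bsub>G\<^esub> y \<cdot> y) \<in> \<beta>"
      unfolding k_def using c xy by (intro sg_congruence_mult[OF \<beta>] sg_congruence_refl[OF \<beta>]) simp_all
    then have kq: "q \<cdot> k = k \<cdot> q" using comm q c by simp
    have x: "x = y \<cdot> k" using c by (simp add: k_def m_assoc[symmetric])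
    have "x \<cdot> q \<cdot> inv\<^bsub>G\<^esub> x = y \<cdot> (k \<cdot> q) \<cdot> (inv\<^bsub>G\<^esub> k \<cdot> inv\<^bsub>G\<^esub> y)"
      unfolding x using c k by (simp add: m_assoc inv_mult_group)
    also have "\<dots> = y \<cdot> q \<cdot> inv\<^bsub>G\<^esub> y"
      unfolding kq[symmetric] using c k by (simp add: m_assoc)
    finally show ?thesis .
  qed
  show "centralizes S \<alpha> \<beta>"
    unfolding centralizes_def term_condition_def
  proof (intro allI impI)
    fix n t a b u v
    assume vars: "term_vars t \<subseteq> {0..n}" and ab: "(a, b) \<in> \<alpha>"
      and uv: "\<forall>i\<in>{1..n}. (u i, v i) \<in> \<beta>"
      and eq: "term_eval S (u(0 := a)) t = term_eval S (v(0 := a)) t"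
    \<comment> \<open>The corners of a square: \<alpha> joins A to B and C to D, while \<beta> joins
      A to C.\<close>
    define A B C D where "A = term_eval S (u(0 := a))" and "B = term_eval S (u(0 := b))"
      and "C = term_eval S (v(0 := a))" and "D = term_eval S (v(0 := b))"
    note defs = A_def B_def C_def D_def
    have c: "a \<in> carrier S" "b \<in> carrier S"
      using ab sg_congruence_carrier1[OF \<alpha>] sg_congruence_carrier2[OF \<alpha>] by blast+
    have uc: "u i \<in> carrier S" "v i \<in> carrier S" if "i \<in> {1..n}" for i
      using uv that sg_congruence_carrier1[OF \<beta>] sg_congruence_carrier2[OF \<beta>] by blast+
    have rel: "(A t, B t) \<in> \<alpha>" "(A t, C t) \<in> \<beta>" "(C t, D t) \<in> \<alpha>"
      if "term_vars t \<subseteq> {0..n}" for t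
    proof -
      have i: "i \<in> {1..n}" if "i \<in> term_vars t" "i \<noteq> 0" for i
        using that \<open>term_vars t \<subseteq> {0..n}\<close> by auto
      show "(A t, B t) \<in> \<alpha>" "(C t, D t) \<in> \<alpha>"
        unfolding defs using i
        by (auto intro!: term_eval_congruence[OF \<alpha>] sg_congruence_refl[OF \<alpha>] simp: ab uc)
      show "(A t, C t) \<in> \<beta>"
        unfolding defs using i uv
        by (auto intro!: term_eval_congruence[OF \<beta>] simp: c sg_congruence_refl[OF \<beta>])
    qed
    have carr: "A t \<in> carrier S" "B t \<in> carrier S" "C t \<in> carrier S" "D t \<in> carrier S"
      if "term_vars t \<subseteq> {0..n}" for t
      using rel[OF that] sg_congruence_carrier1[OF \<alpha>] sg_congruence_carrier2[OF \<alpha>] by blast+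
    \<comment> \<open>The assumed equality \<open>eq\<close> does not pass to subterms, so the
      induction runs on an invariant that does. \<open>eq\<close> enters afterwards, where it
      identifies A t with C t.\<close>
    have main: "B t \<cdot> inv\<^bsub>G\<^esub> A t = D t \<cdot> inv\<^bsub>G\<^esub> C t" if "term_vars t \<subseteq> {0..n}" for t
      using that
    proof (induction t)
      case (TVar i)
      then show ?case using c uc by (cases "i = 0") (auto simp: defs)
    next
      case (TMult s t)
      then have vs: "term_vars s \<subseteq> {0..n}" and vt: "term_vars t \<subseteq> {0..n}" by auto
      note cs = carr[OF vs] carr[OF vt]
      \<comment> \<open>The quotient for the product is p times the conjugate of q by A s. By
        induction p and q are the same for C and D, and \<open>conj\<close> replaces A s by C
        s.\<close>
      define p q where "p = B s \<cdot> inv\<^bsub>G\<^esub> A s" and "q = B t \<cdot> inv\<^bsub>G\<^esub> A t"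
      have pq: "p \<in> carrier S" "q \<in> carrier S" using cs by (simp_all add: p_def q_def)
      have "p = D s \<cdot> inv\<^bsub>G\<^esub> C s" using TMult.IH(1)[OF vs] by (simp add: p_def)
      with p_def have s: "B s = p \<cdot> A s" "D s = p \<cdot> C s"
        using cs by (auto intro: eq_mult_if_inv)
      have "q = D t \<cdot> inv\<^bsub>G\<^esub> C t" using TMult.IH(2)[OF vt] by (simp add: q_def)
      with q_def have t: "B t = q \<cdot> A t" "D t = q \<cdot> C t"
        using cs by (auto intro: eq_mult_if_inv)
      have "(q, e) \<in> \<alpha>"
        unfolding q_def using rel(1)[OF vt] cs
        by (simp add: class_one_iff[OF \<alpha>] sg_congruence_sym[OF \<alpha>])
      from conj[OF this rel(2)[OF vs]]
      have "A s \<cdot> q \<cdot> inv\<^bsub>G\<^esub> A s = C s \<cdot> q \<cdot> inv\<^bsub>G\<^esub> C s" .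
      moreover have "p \<cdot> x \<cdot> (q \<cdot> y) \<cdot> inv\<^bsub>G\<^esub> (x \<cdot> y) = p \<cdot> (x \<cdot> q \<cdot> inv\<^bsub>G\<^esub> x)"
        if "x \<in> carrier S" "y \<in> carrier S" for x y
        using that pq by (simp add: inv_mult_group m_assoc)
      ultimately have "p \<cdot> A s \<cdot> (q \<cdot> A t) \<cdot> inv\<^bsub>G\<^esub> (A s \<cdot> A t)
          = p \<cdot> C s \<cdot> (q \<cdot> C t) \<cdot> inv\<^bsub>G\<^esub> (C s \<cdot> C t)"
        using cs by simp
      then show ?case
        using s t by (simp add: defs)
    next
      case (TInv t)
      then have vt: "term_vars t \<subseteq> {0..n}" by simp
      note ct = carr[OF vt]
      define p where "p = B t \<cdot> inv\<^bsub>G\<^esub> A t"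
      have p: "p \<in> carrier S" using ct by (simp add: p_def)
      have "p = D t \<cdot> inv\<^bsub>G\<^esub> C t" using TInv.IH[OF vt] by (simp add: p_def)
      with p_def have t: "B t = p \<cdot> A t" "D t = p \<cdot> C t"
        using ct by (auto intro: eq_mult_if_inv)
      \<comment> \<open>From B t = p A t, the quotient for the inverse term is the conjugate of p^-1
        by (A t)^-1, so \<open>conj\<close> applies once more.\<close>
      have "(p, e) \<in> \<alpha>"
        unfolding p_def using rel(1)[OF vt] ct
        by (simp add: class_one_iff[OF \<alpha>] sg_congruence_sym[OF \<alpha>])
      from sg_congruence_inv[OF \<alpha> this] have "(inv\<^bsub>G\<^esub> p, e) \<in> \<alpha>" using p by (simp add: sg_inv)
      moreover have "(inv\<^bsub>G\<^esub> A t, inv\<^bsub>G\<^esub> C t) \<in> \<beta>"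
        using sg_congruence_inv[OF \<beta> rel(2)[OF vt]] ct by (simp add: sg_inv)
      ultimately have "inv\<^bsub>G\<^esub> A t \<cdot> inv\<^bsub>G\<^esub> p \<cdot> inv\<^bsub>G\<^esub> (inv\<^bsub>G\<^esub> A t)
          = inv\<^bsub>G\<^esub> C t \<cdot> inv\<^bsub>G\<^esub> p \<cdot> inv\<^bsub>G\<^esub> (inv\<^bsub>G\<^esub> C t)"
        by (rule conj)
      then have "inv\<^bsub>G\<^esub> B t \<cdot> inv\<^bsub>G\<^esub> (inv\<^bsub>G\<^esub> A t) = inv\<^bsub>G\<^esub> D t \<cdot> inv\<^bsub>G\<^esub> (inv\<^bsub>G\<^esub> C t)"
        using ct p by (simp add: t inv_mult_group)
      then show ?case using ct by (simp add: defs sg_inv)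
    qed
    have "B t = (B t \<cdot> inv\<^bsub>G\<^esub> A t) \<cdot> A t" using carr[OF vars] by (simp add: m_assoc)
    also have "\<dots> = (D t \<cdot> inv\<^bsub>G\<^esub> C t) \<cdot> C t" using main[OF vars] eq by (simp add: A_def C_def)
    also have "\<dots> = D t" using carr[OF vars] by (simp add: m_assoc)
    finally show "term_eval S (u(0 := b)) t = term_eval S (v(0 := b)) t"
      by (simp add: B_def D_def)
  qed
qed

section \<open>Abelian and central factors of a group\<close>

lemma quot_group_algebra:
  assumes \<alpha>: "sg_congruence S \<alpha>"
  shows "group_algebra (quot_algebra S \<alpha>) (\<alpha> `` {e})"
proof -
  let ?Q = "as_monoid (quot_algebra S \<alpha>) (\<alpha> `` {e})"
  note mult = quot_mult[OF \<alpha>]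
  have grp: "Group.group ?Q"
  proof (rule groupI; simp)
    show "\<alpha> `` {e} \<in> carrier S // \<alpha>" by (simp add: quotientI)
    fix X assume X: "X \<in> carrier S // \<alpha>"
    then obtain x where x: "x \<in> carrier S" "X = \<alpha> `` {x}" by (auto elim: quotientE)
    show "\<alpha> `` {e} \<cdot>\<^bsub>quot_algebra S \<alpha>\<^esub> X = X" using x by (simp add: mult)
    show "\<exists>Y\<in>carrier S // \<alpha>. Y \<cdot>\<^bsub>quot_algebra S \<alpha>\<^esub> X = \<alpha> `` {e}"
      using x by (intro bexI[of _ "\<alpha> `` {inv\<^bsub>G\<^esub> x}"]) (simp_all add: mult quotientI)
    fix Y assume "Y \<in> carrier S // \<alpha>"
    then obtain y where y: "y \<in> carrier S" "Y = \<alpha> `` {y}" by (auto elim: quotientE)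
    show "X \<cdot>\<^bsub>quot_algebra S \<alpha>\<^esub> Y \<in> carrier S // \<alpha>"
      using x y by (simp add: mult quotientI)
    fix Z assume "Z \<in> carrier S // \<alpha>"
    then obtain z where z: "z \<in> carrier S" "Z = \<alpha> `` {z}" by (auto elim: quotientE)
    show "X \<cdot>\<^bsub>quot_algebra S \<alpha>\<^esub> Y \<cdot>\<^bsub>quot_algebra S \<alpha>\<^esub> Z
        = X \<cdot>\<^bsub>quot_algebra S \<alpha>\<^esub> (Y \<cdot>\<^bsub>quot_algebra S \<alpha>\<^esub> Z)"
      using x y z by (simp add: mult m_assoc)
  qed
  moreover have "sg_inv (quot_algebra S \<alpha>) X = inv\<^bsub>?Q\<^esub> X"
    if "X \<in> carrier (quot_algebra S \<alpha>)" for X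
  proof -
    from that obtain x where x: "x \<in> carrier S" "X = \<alpha> `` {x}" by (auto elim: quotientE)
    then show ?thesis
      by (intro group.inv_equality[OF grp, symmetric])
        (simp_all add: quot_inv[OF \<alpha>] sg_inv mult quotientI)
  qed
  ultimately show ?thesis by (rule group_algebra.intro)
qed

text \<open>This is \<open>centralizes_iff\<close> in S/\<alpha>, pulled back along the quotient
  map: the unit class of a quotient congruence consists of the images of the unit class upstairs,
  and two classes commute iff xy and yx are \<alpha>-related. From here on all conditions on factors
  are stated in S.\<close>

lemma quot_centralizes_iff:
  assumes \<alpha>: "sg_congruence S \<alpha>"
    and \<beta>: "sg_congruence S \<beta>" "\<alpha> \<subseteq> \<beta>" and \<gamma>: "sg_congruence S \<gamma>" "\<alpha> \<subseteq> \<gamma>"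
  shows "centralizes (quot_algebra S \<alpha>) (quot_cong \<beta> \<alpha>) (quot_cong \<gamma> \<alpha>) \<longleftrightarrow>
    (\<forall>x y. (x, e) \<in> \<beta> \<longrightarrow> (y, e) \<in> \<gamma> \<longrightarrow> (x \<cdot> y, y \<cdot> x) \<in> \<alpha>)"
proof -
  interpret Q: group_algebra "quot_algebra S \<alpha>" "\<alpha> `` {e}" by (rule quot_group_algebra[OF \<alpha>])
  have class_ex: "(X, \<alpha> `` {e}) \<in> quot_cong \<delta> \<alpha> \<longleftrightarrow> (\<exists>x. X = \<alpha> `` {x} \<and> (x, e) \<in> \<delta>)"
    if \<delta>: "sg_congruence S \<delta>" "\<alpha> \<subseteq> \<delta>" for X \<delta>
  proof
    assume X: "(X, \<alpha> `` {e}) \<in> quot_cong \<delta> \<alpha>"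
    then obtain x where x: "X = \<alpha> `` {x}" "x \<in> carrier S"
      unfolding quot_cong_def using sg_congruence_carrier1[OF \<delta>(1)] by blast
    then show "\<exists>x. X = \<alpha> `` {x} \<and> (x, e) \<in> \<delta>"
      using X quot_cong_iff[OF \<alpha> \<delta> x(2) one_closed] by blast
  qed (auto simp: quot_cong_def)
  have mult: "\<alpha> `` {x} \<cdot>\<^bsub>quot_algebra S \<alpha>\<^esub> \<alpha> `` {y} = \<alpha> `` {y} \<cdot>\<^bsub>quot_algebra S \<alpha>\<^esub> \<alpha> `` {x}
      \<longleftrightarrow> (x \<cdot> y, y \<cdot> x) \<in> \<alpha>" if "(x, e) \<in> \<beta>" "(y, e) \<in> \<gamma>" for x y
    using sg_congruence_carrier1[OF \<beta>(1) that(1)] sg_congruence_carrier1[OF \<gamma>(1) that(2)]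
    by (simp add: quot_mult[OF \<alpha>] quot_class_eq_iff[OF \<alpha>])
  have "centralizes (quot_algebra S \<alpha>) (quot_cong \<beta> \<alpha>) (quot_cong \<gamma> \<alpha>) \<longleftrightarrow>
      (\<forall>x y. (x, e) \<in> \<beta> \<longrightarrow> (y, e) \<in> \<gamma> \<longrightarrow>
        \<alpha> `` {x} \<cdot>\<^bsub>quot_algebra S \<alpha>\<^esub> \<alpha> `` {y} = \<alpha> `` {y} \<cdot>\<^bsub>quot_algebra S \<alpha>\<^esub> \<alpha> `` {x})"
    unfolding Q.centralizes_iff[OF quot_cong_congruence[OF \<alpha> \<beta>] quot_cong_congruence[OF \<alpha> \<gamma>]]
      class_ex[OF \<beta>] class_ex[OF \<gamma>]
    by blast
  then show ?thesis using mult by simp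
qed

lemma abelian_quot_iff:
  assumes \<alpha>: "sg_congruence S \<alpha>" and \<beta>: "sg_congruence S \<beta>" "\<alpha> \<subseteq> \<beta>"
  shows "abelian_cong (quot_algebra S \<alpha>) (quot_cong \<beta> \<alpha>) \<longleftrightarrow>
    (\<forall>x y. (x, e) \<in> \<beta> \<longrightarrow> (y, e) \<in> \<beta> \<longrightarrow> (x \<cdot> y, y \<cdot> x) \<in> \<alpha>)"
  by (simp add: abelian_cong_def quot_cong_congruence[OF assms] quot_centralizes_iff[OF \<alpha> \<beta> \<beta>])

text \<open>The case \<gamma> = 1 of the previous criterion; \<open>one_cong_quot\<close> presents
  the full congruence of S/\<alpha> as a quotient congruence.\<close>

lemma central_quot_iff:
  assumes \<alpha>: "sg_congruence S \<alpha>" and \<beta>: "sg_congruence S \<beta>" "\<alpha> \<subseteq> \<beta>"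
  shows "central_cong (quot_algebra S \<alpha>) (quot_cong \<beta> \<alpha>) \<longleftrightarrow>
    (\<forall>x y. (x, e) \<in> \<beta> \<longrightarrow> y \<in> carrier S \<longrightarrow> (x \<cdot> y, y \<cdot> x) \<in> \<alpha>)"
proof -
  have "\<alpha> \<subseteq> one_cong S"
    using equiv_type[OF sg_congruence_equiv[OF \<alpha>]] by (simp add: one_cong_def)
  from quot_centralizes_iff[OF \<alpha> \<beta> one_cong_congruence this] show ?thesis
    unfolding central_cong_def one_cong_quot
    by (simp add: quot_cong_congruence[OF assms]) (simp add: one_cong_def)
qed

section \<open>Congruences and normal subgroups\<close>

lemma rcong_iff:
  "(x, y) \<in> rcong\<^bsub>G\<^esub> N \<longleftrightarrow> x \<in> carrier S \<and> y \<in> carrier S \<and> inv\<^bsub>G\<^esub> x \<cdot> y \<in> N"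
  by (simp add: r_congruent_def)

text \<open>Normality serves both operations: (xy)^-1 x'y' is a conjugate of x^-1 x' times y^-1 y',
  and the relation between x^-1 and y^-1 is tested by a conjugate of (x^-1 y)^-1.\<close>

lemma rcong_congruence:
  assumes "N \<lhd> G"
  shows "sg_congruence S (rcong\<^bsub>G\<^esub> N)"
proof -
  interpret N: normal N G by fact
  have sub: "N \<subseteq> carrier S" using N.subset by simp
  have "equiv (carrier S) (rcong\<^bsub>G\<^esub> N)"
    using N.equiv_rcong[OF group] by simp
  moreover have "inv\<^bsub>G\<^esub> (x \<cdot> y) \<cdot> (x' \<cdot> y') \<in> N"
    if c: "x \<in> carrier S" "x' \<in> carrier S" "y \<in> carrier S" "y' \<in> carrier S"
      and N: "inv\<^bsub>G\<^esub> x \<cdot> x' \<in> N" "inv\<^bsub>G\<^esub> y \<cdot> y' \<in> N" for x x' y y'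
  proof -
    have "inv\<^bsub>G\<^esub> y \<cdot> (inv\<^bsub>G\<^esub> x \<cdot> x') \<cdot> y \<in> N" using N.inv_op_closed1[of y] c N by simp
    then have "(inv\<^bsub>G\<^esub> y \<cdot> (inv\<^bsub>G\<^esub> x \<cdot> x') \<cdot> y) \<cdot> (inv\<^bsub>G\<^esub> y \<cdot> y') \<in> N"
      using N.m_closed N(2) by simp
    also have "(inv\<^bsub>G\<^esub> y \<cdot> (inv\<^bsub>G\<^esub> x \<cdot> x') \<cdot> y) \<cdot> (inv\<^bsub>G\<^esub> y \<cdot> y')
        = inv\<^bsub>G\<^esub> y \<cdot> (inv\<^bsub>G\<^esub> x \<cdot> x') \<cdot> (y \<cdot> inv\<^bsub>G\<^esub> y) \<cdot> y'"
      using c by (simp add: m_assoc del: r_inv)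
    also have "\<dots> = inv\<^bsub>G\<^esub> (x \<cdot> y) \<cdot> (x' \<cdot> y')"
      using c by (simp add: m_assoc inv_mult_group)
    finally show ?thesis .
  qed
  moreover have "inv\<^bsub>G\<^esub> (inv\<^bsub>G\<^esub> x) \<cdot> inv\<^bsub>G\<^esub> y \<in> N"
    if c: "x \<in> carrier S" "y \<in> carrier S" and N: "inv\<^bsub>G\<^esub> x \<cdot> y \<in> N" for x y
  proof -
    have "x \<cdot> inv\<^bsub>G\<^esub> (inv\<^bsub>G\<^esub> x \<cdot> y) \<cdot> inv\<^bsub>G\<^esub> x \<in> N"
      using N.inv_op_closed2[of x] N.m_inv_closed[OF N] c by simp
    also have "x \<cdot> inv\<^bsub>G\<^esub> (inv\<^bsub>G\<^esub> x \<cdot> y) \<cdot> inv\<^bsub>G\<^esub> x = inv\<^bsub>G\<^esub> (inv\<^bsub>G\<^esub> x) \<cdot> inv\<^bsub>G\<^esub> y"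
      using c by (simp add: inv_mult_group m_assoc)
    finally show ?thesis .
  qed
  ultimately show ?thesis by (auto simp: sg_congruence_def rcong_iff sg_inv)
qed

text \<open>Recovers N as the class of the unit, so the factor criteria, which speak about unit
  classes, become conditions on N.\<close>

lemma rcong_one_iff:
  assumes "N \<lhd> G"
  shows "(x, e) \<in> rcong\<^bsub>G\<^esub> N \<longleftrightarrow> x \<in> N"
proof -
  interpret N: normal N G by fact
  have "inv\<^bsub>G\<^esub> x \<in> N \<longleftrightarrow> x \<in> N" if "x \<in> carrier S"
    using that N.m_inv_closed[of x] N.m_inv_closed[of "inv\<^bsub>G\<^esub> x"] by auto
  moreover have "x \<in> carrier S" if "x \<in> N" using N.subset that by auto
  ultimately show ?thesis by (cases "x \<in> carrier S") (simp_all add: rcong_iff, blast)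
qed

lemma rcong_chain:
  assumes "H 0 = {e}" "H n = carrier S" "\<And>i. i \<le> n \<Longrightarrow> H i \<lhd> G" "\<And>i. i < n \<Longrightarrow> H i \<subseteq> H (Suc i)"
  shows "congruence_chain S n (\<lambda>i. rcong\<^bsub>G\<^esub> (H i))"
proof -
  have "rcong\<^bsub>G\<^esub> {e} = zero_cong S"
  proof -
    have "inv\<^bsub>G\<^esub> x \<cdot> y = e \<longleftrightarrow> x = y" if "x \<in> carrier S" "y \<in> carrier S" for x y
      using that inv_solve_left'[of e x y] by (simp add: eq_commute)
    then show ?thesis by (auto simp: rcong_iff zero_cong_def)
  qed
  moreover have "rcong\<^bsub>G\<^esub> (carrier S) = one_cong S"
    by (auto simp: rcong_iff one_cong_def)
  moreover have "rcong\<^bsub>G\<^esub> (H i) \<subseteq> rcong\<^bsub>G\<^esub> (H (Suc i))" if "i < n" for i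
    using assms(4)[OF that] by (auto simp: rcong_iff)
  ultimately show ?thesis
    using assms(1-3) by (simp add: congruence_chain_def rcong_congruence)
qed

section \<open>Commutators and central factors\<close>

lemma rcong_mult_commute_iff:
  assumes "N \<lhd> G" "x \<in> carrier S" "y \<in> carrier S"
  shows "(x \<cdot> y, y \<cdot> x) \<in> rcong\<^bsub>G\<^esub> N \<longleftrightarrow> x \<cdot> y \<cdot> inv\<^bsub>G\<^esub> x \<cdot> inv\<^bsub>G\<^esub> y \<in> N"
  using assms class_one_iff[OF rcong_congruence[OF assms(1)], of "x \<cdot> y" "y \<cdot> x"]
    rcong_one_iff[OF assms(1), of "x \<cdot> y \<cdot> inv\<^bsub>G\<^esub> (y \<cdot> x)"]
  by (simp add: inv_mult_group m_assoc)

lemma class_one_mult_commute_iff: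
  assumes \<alpha>: "sg_congruence S \<alpha>" and "x \<in> carrier S" "y \<in> carrier S"
  shows "(x \<cdot> y, y \<cdot> x) \<in> \<alpha> \<longleftrightarrow> (x \<cdot> y \<cdot> inv\<^bsub>G\<^esub> x \<cdot> inv\<^bsub>G\<^esub> y, e) \<in> \<alpha>"
  using assms class_one_iff[OF \<alpha>, of "x \<cdot> y" "y \<cdot> x"] by (simp add: inv_mult_group m_assoc)

text \<open>The carrier of the factor consists of the cosets Nx with x in H, and Nx commutes with Ny
  iff the commutator of x and y lies in N. This brings \<open>nilpotent_group\<close> into the same
  form as \<open>central_quot_iff\<close>.\<close>

lemma factor_central_iff:
  assumes N: "N \<lhd> G" and "H \<subseteq> carrier S"
  shows "carrier (G\<lparr>carrier := H\<rparr> Mod N) \<subseteq> group_center (G Mod N) \<longleftrightarrow>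
    (\<forall>x\<in>H. \<forall>y\<in>carrier S. x \<cdot> y \<cdot> inv\<^bsub>G\<^esub> x \<cdot> inv\<^bsub>G\<^esub> y \<in> N)"
proof -
  interpret N: normal N G by fact
  have *: "(N #>\<^bsub>G\<^esub> x) <#>\<^bsub>G\<^esub> (N #>\<^bsub>G\<^esub> y) = (N #>\<^bsub>G\<^esub> y) <#>\<^bsub>G\<^esub> (N #>\<^bsub>G\<^esub> x) \<longleftrightarrow>
      x \<cdot> y \<cdot> inv\<^bsub>G\<^esub> x \<cdot> inv\<^bsub>G\<^esub> y \<in> N" if c: "x \<in> carrier S" "y \<in> carrier S" for x y
  proof -
    have "(N #>\<^bsub>G\<^esub> x) <#>\<^bsub>G\<^esub> (N #>\<^bsub>G\<^esub> y) = (N #>\<^bsub>G\<^esub> y) <#>\<^bsub>G\<^esub> (N #>\<^bsub>G\<^esub> x) \<longleftrightarrow>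
        N #>\<^bsub>G\<^esub> (x \<cdot> y) = N #>\<^bsub>G\<^esub> (y \<cdot> x)"
      using N.rcos_sum c by simp
    also have "\<dots> \<longleftrightarrow> x \<cdot> y \<in> N #>\<^bsub>G\<^esub> (y \<cdot> x)"
      using c N.subgroup_axioms repr_independence[of "x \<cdot> y" N "y \<cdot> x"] rcos_self[of "x \<cdot> y" N]
      by auto
    also have "\<dots> \<longleftrightarrow> x \<cdot> y \<cdot> inv\<^bsub>G\<^esub> (y \<cdot> x) \<in> N"
      using N.rcos_module[OF group, of "y \<cdot> x" "x \<cdot> y"] c by simp
    finally show ?thesis using c by (simp add: inv_mult_group m_assoc)
  qed
  have rcosets: "rcosets\<^bsub>G\<^esub> N = (\<lambda>y. N #>\<^bsub>G\<^esub> y) ` carrier S"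
    by (auto simp: RCOSETS_def)
  have "carrier (G\<lparr>carrier := H\<rparr> Mod N) = (\<lambda>x. N #>\<^bsub>G\<^esub> x) ` H"
    by (auto simp: FactGroup_def RCOSETS_def)
  moreover have "N #>\<^bsub>G\<^esub> x \<in> group_center (G Mod N) \<longleftrightarrow>
      (\<forall>y\<in>carrier S. x \<cdot> y \<cdot> inv\<^bsub>G\<^esub> x \<cdot> inv\<^bsub>G\<^esub> y \<in> N)" if "x \<in> carrier S" for x
    using that * by (simp add: group_center_def FactGroup_def rcosets)
  ultimately show ?thesis
    using assms(2) by (simp add: image_subset_iff subsetD)
qed

section \<open>Nilpotency and solvability of groups\<close>

lemma ua_nilpotent_imp:
  assumes "ua_nilpotent S"
  shows "nilpotent_group G"
proof -
  obtain n \<alpha> where chain: "congruence_chain S n \<alpha>"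
    and cent: "\<And>i. i < n \<Longrightarrow> central_cong (quot_algebra S (\<alpha> i)) (quot_cong (\<alpha> (Suc i)) (\<alpha> i))"
    using assms by (auto simp: ua_nilpotent_def)
  have cong: "sg_congruence S (\<alpha> i)" if "i \<le> n" for i
    using chain that by (simp add: congruence_chain_def)
  have sub: "\<alpha> i \<subseteq> \<alpha> (Suc i)" if "i < n" for i
    using chain that by (simp add: congruence_chain_def)
  \<comment> \<open>The unit classes of the congruences serve as the central series.\<close>
  let ?H = "\<lambda>i. {x. (x, e) \<in> \<alpha> i}"
  have "carrier (G\<lparr>carrier := ?H (Suc i)\<rparr> Mod ?H i) \<subseteq> group_center (G Mod ?H i)"
    if i: "i < n" for i
  proof -
    note cs = cong[of i] cong[of "Suc i"] sub[OF i]
    have "?H (Suc i) \<subseteq> carrier S" using sg_congruence_carrier1[OF cs(2)] i by auto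
    moreover have "(x \<cdot> y \<cdot> inv\<^bsub>G\<^esub> x \<cdot> inv\<^bsub>G\<^esub> y, e) \<in> \<alpha> i"
      if "(x, e) \<in> \<alpha> (Suc i)" "y \<in> carrier S" for x y
    proof -
      have "(x \<cdot> y, y \<cdot> x) \<in> \<alpha> i"
        using cent[OF i] that i by (simp add: central_quot_iff[OF cs])
      then show ?thesis
        using that i sg_congruence_carrier1[OF cs(2) that(1)]
        by (simp add: class_one_mult_commute_iff[OF cs(1)])
    qed
    ultimately show ?thesis
      using i class_one_normal[OF cs(1)] by (simp add: factor_central_iff)
  qed
  moreover have "?H 0 = {e}" "?H n = carrier S"
    using chain by (auto simp: congruence_chain_def zero_cong_def one_cong_def)
  ultimately show ?thesis
    using group cong subsetD[OF sub] unfolding nilpotent_group_def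
    by (intro conjI exI[of _ n] exI[of _ ?H]) (simp_all add: class_one_normal Collect_mono)
qed

lemma nilpotent_imp_ua:
  assumes "nilpotent_group G"
  shows "ua_nilpotent S"
proof -
  obtain n H where H: "H 0 = {e}" "H n = carrier S" "\<And>i. i \<le> n \<Longrightarrow> H i \<lhd> G"
    "\<And>i. i < n \<Longrightarrow> H i \<subseteq> H (Suc i)"
    and cent: "\<And>i. i < n \<Longrightarrow>
      carrier (G\<lparr>carrier := H (Suc i)\<rparr> Mod H i) \<subseteq> group_center (G Mod H i)"
    using assms by (auto simp: nilpotent_group_def)
  note chain = rcong_chain[of H, OF H]
  have "central_cong (quot_algebra S (rcong\<^bsub>G\<^esub> (H i))) (quot_cong (rcong\<^bsub>G\<^esub> (H (Suc i))) (rcong\<^bsub>G\<^esub> (H i)))"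
    if i: "i < n" for i
  proof -
    have N: "H i \<lhd> G" "H (Suc i) \<lhd> G" using H(3) i by simp_all
    have sub: "H (Suc i) \<subseteq> carrier S"
      using subgroup.subset[OF normal_imp_subgroup[OF N(2)]] by simp
    have rsub: "rcong\<^bsub>G\<^esub> (H i) \<subseteq> rcong\<^bsub>G\<^esub> (H (Suc i))" using H(4)[OF i] by (auto simp: rcong_iff)
    show ?thesis
      using cent[OF i] sub
      by (auto simp: central_quot_iff[OF rcong_congruence[OF N(1)] rcong_congruence[OF N(2)] rsub]
          rcong_one_iff[OF N(2)] factor_central_iff[OF N(1) sub] rcong_mult_commute_iff[OF N(1)])
  qed
  then show ?thesis using chain unfolding ua_nilpotent_def by blast
qed

text \<open>The unit classes of the chain need not form the derived series, but they bound it: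
  abelian factors put the derived subgroup of each unit class inside the preceding one, so the k-th
  derived subgroup lies in the unit class of index n - k.\<close>

lemma ua_solvable_imp:
  assumes "ua_solvable S"
  shows "solvable_group G"
proof -
  obtain n \<alpha> where chain: "congruence_chain S n \<alpha>"
    and ab: "\<And>i. i < n \<Longrightarrow> abelian_cong (quot_algebra S (\<alpha> i)) (quot_cong (\<alpha> (Suc i)) (\<alpha> i))"
    using assms by (auto simp: ua_solvable_def)
  let ?H = "\<lambda>i. {x. (x, e) \<in> \<alpha> i}"
  have cong: "sg_congruence S (\<alpha> i)" if "i \<le> n" for i
    using chain that by (simp add: congruence_chain_def)
  have sub: "\<alpha> i \<subseteq> \<alpha> (Suc i)" if "i < n" for i
    using chain that by (simp add: congruence_chain_def)
  have derived: "derived G (?H (Suc i)) \<subseteq> ?H i" if i: "i < n" for i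
  proof -
    note cs = cong[of i] cong[of "Suc i"] sub[OF i]
    have "derived_set G (?H (Suc i)) \<subseteq> ?H i"
    proof -
      have "(x \<cdot> y \<cdot> inv\<^bsub>G\<^esub> x \<cdot> inv\<^bsub>G\<^esub> y, e) \<in> \<alpha> i"
        if "(x, e) \<in> \<alpha> (Suc i)" "(y, e) \<in> \<alpha> (Suc i)" for x y
      proof -
        have "(x \<cdot> y, y \<cdot> x) \<in> \<alpha> i"
          using ab[OF i] that i by (simp add: abelian_quot_iff[OF cs])
        then show ?thesis
          using that i sg_congruence_carrier1[OF cs(2)]
          by (simp add: class_one_mult_commute_iff[OF cs(1)])
      qed
      then show ?thesis by auto
    qed
    then show ?thesis
      unfolding derived_def
      using i normal_imp_subgroup[OF class_one_normal[OF cs(1)]]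
      by (intro generate_subgroup_incl) simp_all
  qed
  have "(derived G ^^ k) (carrier S) \<subseteq> ?H (n - k)" if "k \<le> n" for k
    using that
  proof (induction k)
    case 0
    then show ?case using chain by (auto simp: congruence_chain_def one_cong_def)
  next
    case (Suc k)
    then have "(derived G ^^ Suc k) (carrier S) \<subseteq> derived G (?H (n - k))"
      using mono_derived by simp
    also have "n - k = Suc (n - Suc k)" using Suc.prems by simp
    also have "derived G (?H (Suc (n - Suc k))) \<subseteq> ?H (n - Suc k)"
      using derived Suc.prems by simp
    finally show ?case .
  qed
  from this[of n] have "(derived G ^^ n) (carrier S) \<subseteq> {e}"
    using chain by (auto simp: congruence_chain_def zero_cong_def)
  moreover have "e \<in> (derived G ^^ n) (carrier S)"
    using subgroup.one_closed[OF exp_of_derived_is_subgroup[OF subgroup_self]] by simp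
  ultimately have "(derived G ^^ n) (carrier S) = {e}" by blast
  then show ?thesis
    using group solvable_iff_trivial_derived_seq unfolding solvable_group_def by auto
qed

lemma solvable_imp_ua:
  assumes "solvable_group G"
  shows "ua_solvable S"
proof -
  obtain n where n: "(derived G ^^ n) (carrier S) = {e}"
    using assms solvable_iff_trivial_derived_seq unfolding solvable_group_def by auto
  define D where "D k = (derived G ^^ k) (carrier S)" for k
  \<comment> \<open>Each term must be normal in all of G, not merely in its predecessor, for
    \<open>rcong\<close> to give a congruence of S.\<close>
  have norm: "D k \<lhd> G" for k
    unfolding D_def using normal_self derived_is_normal by (induction k) simp_all
  have sg: "subgroup (D k) G" for k by (rule normal_imp_subgroup[OF norm])
  have D: "derived G (D k) = D (Suc k)" for k by (simp add: D_def)
  have sub: "D k \<subseteq> carrier S" for k using subgroup.subset[OF sg] by simp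
  have desc: "D (Suc k) \<subseteq> D k" for k
    using derived_incl[OF subset_refl sg] by (simp add: D)
  \<comment> \<open>The derived series descends while congruence chains ascend, so the index is
    reversed; i < n keeps the truncated subtraction harmless in \<open>D_Suc\<close>.\<close>
  define H where "H i = D (n - i)" for i
  have D_Suc: "H i = D (Suc (n - Suc i))" if "i < n" for i
    using that by (simp only: H_def Suc_diff_Suc)
  have H: "H 0 = {e}" "H n = carrier S" "\<And>i. i \<le> n \<Longrightarrow> H i \<lhd> G"
    using n norm by (simp_all add: H_def) (simp_all add: D_def)
  have mono: "H i \<subseteq> H (Suc i)" if "i < n" for i
    unfolding D_Suc[OF that] using desc by (simp add: H_def)
  note chain = rcong_chain[of H, OF H mono]
  have "abelian_cong (quot_algebra S (rcong\<^bsub>G\<^esub> (H i))) (quot_cong (rcong\<^bsub>G\<^esub> (H (Suc i))) (rcong\<^bsub>G\<^esub> (H i)))"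
    if i: "i < n" for i
  proof -
    have N: "H i \<lhd> G" "H (Suc i) \<lhd> G" using H(3) i by simp_all
    have rsub: "rcong\<^bsub>G\<^esub> (H i) \<subseteq> rcong\<^bsub>G\<^esub> (H (Suc i))" using mono[OF i] by (auto simp: rcong_iff)
    have eq: "H i = derived G (H (Suc i))" unfolding D_Suc[OF i] by (simp add: H_def D)
    have "(x \<cdot> y, y \<cdot> x) \<in> rcong\<^bsub>G\<^esub> (H i)" if xy: "x \<in> H (Suc i)" "y \<in> H (Suc i)" for x y
    proof -
      have "x \<cdot> y \<cdot> inv\<^bsub>G\<^esub> x \<cdot> inv\<^bsub>G\<^esub> y \<in> H i"
        unfolding eq derived_def by (rule generate.incl) (use xy in auto)
      moreover have "x \<in> carrier S" "y \<in> carrier S"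
        using xy subsetD[OF sub] unfolding H_def by blast+
      ultimately show ?thesis by (simp add: rcong_mult_commute_iff[OF N(1)])
    qed
    then show ?thesis
      unfolding abelian_quot_iff[OF rcong_congruence[OF N(1)] rcong_congruence[OF N(2)] rsub]
        rcong_one_iff[OF N(2)]
      by blast
  qed
  then show ?thesis using chain unfolding ua_solvable_def by blast
qed

end

section \<open>From inverse semigroups to groups\<close>

lemma ua_nilpotent_imp_ua_solvable:
  assumes "ua_nilpotent S"
  shows "ua_solvable S"
  using assms central_cong_imp_abelian unfolding ua_nilpotent_def ua_solvable_def by blast

context inverse_semigroup
begin

lemma ua_solvable_group:
  assumes "ua_solvable S"
  obtains e where "group_algebra S e"
  using group_if_idem_unique ua_solvable_idem_unique[OF assms] group_algebraI by metis

text \<open>In the forward direction the unit is obtained through solvability, as central factors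
  are abelian. Conversely, the given unit makes S a \<open>group_algebra\<close>.\<close>

lemma ua_nilpotent_iff: "ua_nilpotent S \<longleftrightarrow> is_nilpotent_group S"
proof
  assume nil: "ua_nilpotent S"
  obtain e where "group_algebra S e"
    by (rule ua_solvable_group[OF ua_nilpotent_imp_ua_solvable[OF nil]])
  from group_algebra.ua_nilpotent_imp[OF this nil] show "is_nilpotent_group S"
    by (auto simp: is_nilpotent_group_def)
next
  assume "is_nilpotent_group S"
  then obtain e where e: "nilpotent_group (as_monoid S e)" by (auto simp: is_nilpotent_group_def)
  then have "group_algebra S e" by (simp add: nilpotent_group_def group_algebraI)
  then show "ua_nilpotent S" using e by (rule group_algebra.nilpotent_imp_ua)
qed

lemma ua_solvable_iff: "ua_solvable S \<longleftrightarrow> is_solvable_group S"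
proof
  assume solv: "ua_solvable S"
  obtain e where "group_algebra S e" by (rule ua_solvable_group[OF solv])
  from group_algebra.ua_solvable_imp[OF this solv] show "is_solvable_group S"
    by (auto simp: is_solvable_group_def)
next
  assume "is_solvable_group S"
  then obtain e where e: "solvable_group (as_monoid S e)" by (auto simp: is_solvable_group_def)
  then have "group_algebra S e" by (simp add: solvable_group_def group_algebraI)
  then show "ua_solvable S" using e by (rule group_algebra.solvable_imp_ua)
qed

end

theorem theorem1p3:
  fixes S :: "'a inv_algebra"
  assumes "inverse_semigroup S"
  shows "(ua_nilpotent S \<longleftrightarrow> is_nilpotent_group S) \<and>
         (ua_solvable S \<longleftrightarrow> is_solvable_group S)"
  using inverse_semigroup.ua_nilpotent_iff[OF assms] inverse_semigroup.ua_solvable_iff[OF assms]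
  by (rule conjI)

end
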